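(* Let $d \geq 3$ and let $C = \mathbb{R}_+ v_1 + \cdots + \mathbb{R}_+ v_d \subset \mathbb{R}^d$ be a simplicial $d$-cone, where $v_1,\dots,v_d \in \mathbb{Z}^d$ are its extreme integral generators, and suppose $\mu(C) = 2^l$ for some $l \in \mathbb{N}$. Then there exists a unimodular triangulation $C = C_1 \cup \cdots \cup C_k$ such that $$\operatorname{Hilb}(C_j) \subset \left( \frac{d}{2}\left(\frac{3}{2}\right)^l \right)\Delta_C, \quad 1 \le j \le k.$$
   Context: A simplicial $d$-cone $C\subset\mathbb{R}^d$ is always taken to be generated by its extreme integral generators $v_1,\dots,v_d$, i.e. the primitive integral vectors on its extreme rays. The multiplicity $\mu(C)=|\det(v_1,\dots,v_d)|$ is the lattice-normalized volume of the simplex $\Delta_C=\operatorname{conv}(0,v_1,\dots,v_d)$; for $c>0$, $c\Delta_C$ denotes the dilated simplex. A cone is unimodular if its multiplicity is $1$. A unimodular triangulation of $C$ is a triangulation (fan subdivision) of $C$ into unimodular simplicial cones. $\operatorname{Hilb}(D)$ denotes the Hilbert basis of the monoid $D\cap\mathbb{Z}^d$; for a unimodular cone $D$ it consists exactly of the extreme integral generators of $D$. *)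

theory Defs
  imports "HOL-Analysis.Analysis"
begin

definition lattice_point :: "real^'n \<Rightarrow> bool" where
  "lattice_point x \<longleftrightarrow> (\<forall>i. x $ i \<in> \<int>)"

definition primitive :: "real^'n \<Rightarrow> bool" where
  "primitive x \<longleftrightarrow> lattice_point x \<and> x \<noteq> 0 \<and>
     (\<forall>(k::nat) y. lattice_point y \<and> x = real k *\<^sub>R y \<longrightarrow> k = 1)"

definition extreme_integral_generators :: "(real^'n) set \<Rightarrow> (real^'n) set" where
  "extreme_integral_generators C = {x. primitive x \<and> (convex_cone hull {x}) face_of C}"

text \<open>The dimension \<open>d\<close> is \<open>CARD('n)\<close>, and \<open>'n\<close> also indexes the \<open>d\<close> generators, so that
  injectivity of \<open>v\<close> makes this a full-dimensional cone.\<close>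

definition simplicial_cone :: "('n \<Rightarrow> real^'n) \<Rightarrow> (real^'n) set \<Rightarrow> bool" where
  "simplicial_cone v C \<longleftrightarrow>
     inj v \<and> independent (range v) \<and> C = convex_cone hull (range v) \<and>
     range v = extreme_integral_generators C"

definition cone_multiplicity :: "('n::finite \<Rightarrow> real^'n) \<Rightarrow> real" where
  "cone_multiplicity v = \<bar>det (\<chi> i j. v j $ i)\<bar>"

definition cone_simplex :: "('n \<Rightarrow> real^'n) \<Rightarrow> (real^'n) set" where
  "cone_simplex v = convex hull (insert 0 (range v))"

definition unimodular_cone :: "(real^'n::finite) set \<Rightarrow> bool" where
  "unimodular_cone D \<longleftrightarrow> (\<exists>w. simplicial_cone w D \<and> cone_multiplicity w = 1)"

text \<open>The fan is given by its maximal cones; the lower-dimensional cones of the fan are the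
  faces of these.\<close>

definition unimodular_triangulation :: "(real^'n::finite) set set \<Rightarrow> (real^'n) set \<Rightarrow> bool" where
  "unimodular_triangulation \<T> C \<longleftrightarrow>
     finite \<T> \<and> (\<forall>D\<in>\<T>. unimodular_cone D) \<and> \<Union>\<T> = C \<and>
     (\<forall>D\<in>\<T>. \<forall>E\<in>\<T>. (D \<inter> E) face_of D \<and> (D \<inter> E) face_of E)"

text \<open>The Hilbert basis of the monoid of lattice points of a pointed cone is its set of
  irreducible elements.\<close>

definition hilbert_basis :: "(real^'n) set \<Rightarrow> (real^'n) set" where
  "hilbert_basis D =
     (let M = {x \<in> D. lattice_point x}
      in {x \<in> M. x \<noteq> 0 \<and> (\<forall>y\<in>M. \<forall>z\<in>M. x = y + z \<longrightarrow> y = 0 \<or> z = 0)})"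

end

theory Submission
  imports Defs "HOL-Library.Z2"
begin

text \<open>If the multiplicity of a cone generated by \<open>w\<^sub>1, \<dots>, w\<^sub>d\<close> is even, the matrix of generators is
  singular modulo 2, so \<open>x = (\<Sum>S) / 2\<close> is a lattice point for some nonempty set \<open>S\<close> of generators.
  Stellar subdivision of the whole triangulation at \<open>x\<close> halves the multiplicity of exactly the cones
  containing \<open>S\<close>, so after finitely many steps all cones are unimodular, each of them having been
  subdivided \<open>l\<close> times. Let \<open>L\<close> be the linear form that is 1 on the \<open>v\<^sub>i\<close>. Then \<open>L x\<close> is at most half
  the sum of the \<open>L w\<^sub>i\<close>, and replacing some \<open>w\<^sub>i\<close> by \<open>x\<close> increases this sum at most by the
  factor \<open>3 / 2\<close>; starting from \<open>d\<close>, after \<open>k\<close> steps it is at most \<open>d (3 / 2)\<^sup>k\<close>.\<close>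

section \<open>Conical combinations and stellar subdivision\<close>

text \<open>A family of cones with generating sets \<open>\<B>\<close> fits together to a fan iff every point of its
  support is a conical combination in only one way. So a triangulation is recorded as injectivity
  of \<open>lincomb\<close> on the coefficient functions \<open>realization \<B>\<close>.\<close>

definition lincomb :: "('a::real_vector \<Rightarrow> real) \<Rightarrow> 'a" where
  "lincomb f = (\<Sum>b | f b \<noteq> 0. f b *\<^sub>R b)"

definition realization :: "'a set set \<Rightarrow> ('a \<Rightarrow> real) set" where
  "realization \<B> = {f. (\<forall>b. 0 \<le> f b) \<and> (\<exists>B\<in>\<B>. {b. f b \<noteq> 0} \<subseteq> B)}"

text \<open>A cell containing \<open>S\<close> gives way to the joins of the apex \<open>x\<close>
  with its facets opposite the elements of \<open>S\<close>. The position of \<open>x\<close> inside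
  the cone over \<open>S\<close> enters as a hypothesis of \<open>stellar_lincomb\<close>.\<close>

definition stellar :: "'a set \<Rightarrow> 'a \<Rightarrow> 'a set set \<Rightarrow> 'a set set" where
  "stellar S x \<B> = {B \<in> \<B>. \<not> S \<subseteq> B} \<union>
     {insert x (B - {s}) | B s. B \<in> \<B> \<and> S \<subseteq> B \<and> s \<in> S}"

lemma lincomb_eq_sum:
  assumes "finite A" "{b. f b \<noteq> 0} \<subseteq> A"
  shows "lincomb f = (\<Sum>b\<in>A. f b *\<^sub>R b)"
  unfolding lincomb_def using assms by (intro sum.mono_neutral_left) auto

lemma realization_mono: "\<A> \<subseteq> \<B> \<Longrightarrow> realization \<A> \<subseteq> realization \<B>"
  unfolding realization_def by blast

lemma realization_UN: "realization \<B> = (\<Union>B\<in>\<B>. realization {B})"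
  unfolding realization_def by auto

text \<open>The bridge between hulls and coefficient functions: the image contains \<open>B\<close>,
  is closed under sums and nonnegative multiples, and lies in every convex cone that contains
  \<open>B\<close>.\<close>

lemma convex_cone_hull_finite:
  fixes B :: "'a::real_vector set"
  assumes "finite B"
  shows "convex_cone hull B = lincomb ` realization {B}"
proof -
  have eq: "lincomb f = (\<Sum>b\<in>B. f b *\<^sub>R b)" if "f \<in> realization {B}" for f
    using that assms by (intro lincomb_eq_sum) (auto simp: realization_def)
  show ?thesis
  proof (rule hull_unique)
    show "B \<subseteq> lincomb ` realization {B}"
    proof
      fix b assume b: "b \<in> B"
      have "lincomb (\<lambda>c. if c = b then 1 else 0) = b"
        unfolding lincomb_def by simp
      moreover have "(\<lambda>c. if c = b then 1 else 0) \<in> realization {B}"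
        using b by (auto simp: realization_def)
      ultimately show "b \<in> lincomb ` realization {B}" by (metis imageI)
    qed
    show "convex_cone (lincomb ` realization {B})"
      unfolding convex_cone_iff
    proof (intro conjI ballI allI impI)
      have "(\<lambda>_. 0) \<in> realization {B}" by (simp add: realization_def)
      moreover have "lincomb (\<lambda>_. 0) = (0::'a)" by (simp add: lincomb_def)
      ultimately show "0 \<in> lincomb ` realization {B}" by (metis imageI)
    next
      fix x y assume "x \<in> lincomb ` realization {B}" "y \<in> lincomb ` realization {B}"
      then obtain f g where fg: "f \<in> realization {B}" "g \<in> realization {B}" "x = lincomb f" "y = lincomb g"
        by auto
      have h: "(\<lambda>b. f b + g b) \<in> realization {B}"
        using fg(1,2) unfolding realization_def by (auto simp: subset_iff) (metis add_0_left)
      then have "x + y = lincomb (\<lambda>b. f b + g b)"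
        using fg eq[OF h] by (simp add: eq scaleR_add_left sum.distrib)
      then show "x + y \<in> lincomb ` realization {B}" using h by auto
    next
      fix x and c :: real assume "x \<in> lincomb ` realization {B}" and c: "0 \<le> c"
      then obtain f where f: "f \<in> realization {B}" "x = lincomb f"
        by auto
      have h: "(\<lambda>b. c * f b) \<in> realization {B}"
        using f(1) c unfolding realization_def by auto
      then have "c *\<^sub>R x = lincomb (\<lambda>b. c * f b)"
        using f eq[OF h] by (simp add: eq scaleR_sum_right)
      then show "c *\<^sub>R x \<in> lincomb ` realization {B}" using h by auto
    qed
  next
    fix T assume T: "B \<subseteq> T" "convex_cone T"
    show "lincomb ` realization {B} \<subseteq> T"
    proof safe
      fix f assume f: "f \<in> realization {B}"
      have "(\<Sum>b\<in>A. f b *\<^sub>R b) \<in> T" if "finite A" "A \<subseteq> B" for A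
        using that
      proof (induction A rule: finite_induct)
        case empty
        then show ?case using T(2) by (simp add: convex_cone_contains_0)
      next
        case (insert a A)
        then have "f a *\<^sub>R a \<in> T"
          using T f by (intro convex_cone_scaleR) (auto simp: realization_def)
        with insert show ?case using T(2) by (simp add: convex_cone_add)
      qed
      then show "lincomb f \<in> T" using eq[OF f] assms by auto
    qed
  qed
qed

lemma lincomb_realization_UN:
  fixes \<B> :: "'a::real_vector set set"
  assumes "\<And>B. B \<in> \<B> \<Longrightarrow> finite B"
  shows "lincomb ` realization \<B> = (\<Union>B\<in>\<B>. convex_cone hull B)"
  using assms by (subst realization_UN) (simp add: image_UN convex_cone_hull_finite)

text \<open>A common point has a coefficient function supported in \<open>A\<close> and one
  supported in \<open>B\<close>. Injectivity identifies them, so the support lies in both.\<close>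

lemma convex_cone_hull_Int:
  fixes A B :: "'a::real_vector set"
  assumes "inj_on lincomb (realization {A, B})" "finite A" "finite B"
  shows "convex_cone hull A \<inter> convex_cone hull B = convex_cone hull (A \<inter> B)"
proof
  show "convex_cone hull (A \<inter> B) \<subseteq> convex_cone hull A \<inter> convex_cone hull B"
    by (simp add: hull_mono)
  show "convex_cone hull A \<inter> convex_cone hull B \<subseteq> convex_cone hull (A \<inter> B)"
  proof
    fix x assume "x \<in> convex_cone hull A \<inter> convex_cone hull B"
    then obtain f g where fg: "f \<in> realization {A}" "g \<in> realization {B}" "x = lincomb f" "x = lincomb g"
      using assms by (auto simp: convex_cone_hull_finite)
    moreover have "f \<in> realization {A, B}" "g \<in> realization {A, B}"
      using fg by (auto simp: realization_def)
    ultimately have "f = g" using assms(1) by (auto dest: inj_onD)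
    with fg have "f \<in> realization {A \<inter> B}" by (auto simp: realization_def)
    then show "x \<in> convex_cone hull (A \<inter> B)"
      using assms fg by (auto simp: convex_cone_hull_finite)
  qed
qed

text \<open>If a point strictly between \<open>a\<close> and \<open>b\<close> lies in the hull of
  \<open>T\<close>, then by uniqueness the mixture of the coefficients of \<open>a\<close> and
  \<open>b\<close> vanishes off \<open>T\<close>. Both are nonnegative with positive weights, so
  each vanishes there.\<close>

lemma face_of_convex_cone_hull_subset:
  fixes B :: "'a::real_vector set"
  assumes inj: "inj_on lincomb (realization {B})" and "finite B" "T \<subseteq> B"
  shows "(convex_cone hull T) face_of (convex_cone hull B)"
  unfolding face_of_def
proof (intro conjI ballI impI)
  have fT: "finite T" using assms finite_subset by blast
  show "convex_cone hull T \<subseteq> convex_cone hull B" using assms by (simp add: hull_mono)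
  show "convex (convex_cone hull T)" by (rule convex_convex_cone_hull)
  fix a b x
  assume "a \<in> convex_cone hull B" "b \<in> convex_cone hull B" "x \<in> convex_cone hull T"
    and seg: "x \<in> open_segment a b"
  then obtain f g h where fg: "f \<in> realization {B}" "g \<in> realization {B}" "h \<in> realization {T}"
      "a = lincomb f" "b = lincomb g" "x = lincomb h"
    using assms fT by (auto simp: convex_cone_hull_finite)
  obtain u where u: "0 < u" "u < 1" "x = (1 - u) *\<^sub>R a + u *\<^sub>R b"
    using seg by (auto simp: in_segment)
  define k where "k = (\<lambda>b. (1 - u) * f b + u * g b)"
  have k: "k \<in> realization {B}"
    using fg u unfolding realization_def k_def by (auto simp: subset_iff) (metis add_0_left mult_zero_right)
  have eq: "lincomb f = (\<Sum>b\<in>B. f b *\<^sub>R b)" if "f \<in> realization {B}" for f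
    using that assms by (intro lincomb_eq_sum) (auto simp: realization_def)
  have "lincomb k = x"
    using fg(1,2,4,5) k u(3)
    by (simp add: eq) (simp add: k_def scaleR_add_left sum.distrib scaleR_sum_right)
  moreover have "h \<in> realization {B}" using fg assms by (auto simp: realization_def)
  ultimately have "k = h" using inj k fg by (auto dest: inj_onD)
  have z: "f c = 0 \<and> g c = 0" if "c \<notin> T" for c
  proof -
    have "(1 - u) * f c + u * g c = 0"
      using that fg(3) \<open>k = h\<close> by (auto simp: realization_def k_def fun_eq_iff)
    moreover have "0 \<le> (1 - u) * f c" "0 \<le> u * g c"
      using fg u by (auto simp: realization_def)
    ultimately show ?thesis using u by (auto simp: add_nonneg_eq_0_iff)
  qed
  then have "f \<in> realization {T}" "g \<in> realization {T}"
    using fg by (auto simp: realization_def)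
  then show "a \<in> convex_cone hull T" "b \<in> convex_cone hull T"
    using fg fT by (auto simp: convex_cone_hull_finite)
qed

text \<open>Stellar subdivision preserves the support and the uniqueness of coefficients. Both
  follow from a translation \<open>\<phi>\<close> of new coefficient functions into old ones that
  keeps the represented point.\<close>

lemma stellar_lincomb:
  fixes \<B> :: "'a::real_vector set set"
  assumes fin: "\<And>B. B \<in> \<B> \<Longrightarrow> finite B" and inj: "inj_on lincomb (realization \<B>)"
    and S: "S \<noteq> {}" "S \<subseteq> B0" "B0 \<in> \<B>" and x: "x = r *\<^sub>R \<Sum>S" "0 < r" "x \<notin> \<Union>\<B>"
  shows "inj_on lincomb (realization (stellar S x \<B>))"
    and "lincomb ` realization (stellar S x \<B>) = lincomb ` realization \<B>"
proof -
  have fS: "finite S" using S fin finite_subset by blast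
  have xS: "x \<notin> S" using S x by blast
  \<comment> \<open>The term at \<open>x\<close> is expanded by
    \<open>x = r *\<^sub>R \<Sum>S\<close>, so every element of \<open>S\<close> receives an
    additional \<open>r * f x\<close>.\<close>
  define \<phi> where "\<phi> f = (\<lambda>b. if b = x then 0 else f b + (if b \<in> S then r * f x else 0))" for f
  have lin: "lincomb (\<phi> f) = lincomb f"
    if B: "B \<in> \<B>" and "f x \<noteq> 0 \<Longrightarrow> S \<subseteq> B" "{b. f b \<noteq> 0} \<subseteq> insert x B" for f B
  proof -
    have xB: "x \<notin> B" using x B by auto
    have "lincomb f = (\<Sum>b\<in>insert x B. f b *\<^sub>R b)"
      using that fin by (intro lincomb_eq_sum) auto
    also have "\<dots> = f x *\<^sub>R x + (\<Sum>b\<in>B. f b *\<^sub>R b)"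
      using xB fin[OF B] by simp
    also have "f x *\<^sub>R x = (\<Sum>b\<in>S. (r * f x) *\<^sub>R b)"
      by (subst x(1)) (simp add: scaleR_sum_right mult.commute)
    also have "\<dots> = (\<Sum>b\<in>B. (if b \<in> S then r * f x else 0) *\<^sub>R b)"
    proof (cases "f x = 0")
      case False
      then have "S \<subseteq> B" using that by blast
      then show ?thesis
        using fin[OF B] by (intro sum.mono_neutral_cong_left) auto
    qed (simp add: sum.neutral)
    also have "\<dots> + (\<Sum>b\<in>B. f b *\<^sub>R b) = (\<Sum>b\<in>B. \<phi> f b *\<^sub>R b)"
      unfolding \<phi>_def sum.distrib[symmetric] using xB
      by (intro sum.cong) (auto simp: scaleR_add_left)
    also have "\<dots> = lincomb (\<phi> f)"
    proof (rule lincomb_eq_sum[symmetric])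
      show "{b. \<phi> f b \<noteq> 0} \<subseteq> B"
        using that by (cases "f x = 0") (auto simp: \<phi>_def split: if_splits)
    qed (rule fin[OF B])
    finally show ?thesis by simp
  qed
  \<comment> \<open>Every cell of the subdivision omits some element of \<open>S\<close>. The
    resulting zero coefficient is what makes \<open>f x\<close> recoverable from
    \<open>\<phi> f\<close>.\<close>
  have \<phi>: "\<phi> f \<in> realization \<B> \<and> lincomb (\<phi> f) = lincomb f \<and> (\<exists>s\<in>S. f s = 0)"
    if f: "f \<in> realization (stellar S x \<B>)" for f
  proof -
    have nn: "0 \<le> f b" for b using f by (auto simp: realization_def)
    from f obtain B' where B': "B' \<in> stellar S x \<B>" "{b. f b \<noteq> 0} \<subseteq> B'"
      by (auto simp: realization_def)
    then consider "B' \<in> \<B>" "\<not> S \<subseteq> B'"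
      | B s where "B \<in> \<B>" "S \<subseteq> B" "s \<in> S" "B' = insert x (B - {s})"
      unfolding stellar_def by blast
    then show ?thesis
    proof cases
      case 1
      then have fx: "f x = 0" using B' x by auto
      then have "\<phi> f = f" by (auto simp: \<phi>_def)
      then show ?thesis using 1 B' f unfolding realization_def by auto
    next
      case 2
      have "f s = 0" using 2 B' xS by auto
      moreover have "{b. \<phi> f b \<noteq> 0} \<subseteq> B"
        using B' 2 by (auto simp: \<phi>_def split: if_splits)
      moreover have "0 \<le> \<phi> f b" for b using nn x by (auto simp: \<phi>_def)
      moreover have "lincomb (\<phi> f) = lincomb f"
        using 2 B' by (intro lin[of B]) auto
      ultimately show ?thesis using 2 by (auto simp: realization_def)
    qed
  qed
  show "inj_on lincomb (realization (stellar S x \<B>))"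
  proof (rule inj_onI)
    fix f g assume f: "f \<in> realization (stellar S x \<B>)" and g: "g \<in> realization (stellar S x \<B>)"
      and "lincomb f = lincomb g"
    then have eq: "\<phi> f b = \<phi> g b" for b using \<phi>[OF f] \<phi>[OF g] inj by (metis inj_onD)
    \<comment> \<open>The value at \<open>x\<close> is recovered as the minimum of \<open>\<phi> f\<close> over \<open>S\<close>, divided by \<open>r\<close>.\<close>
    have le: "h x \<le> k x" if "s \<in> S" "k s = 0" "0 \<le> h s" "\<phi> h s = \<phi> k s" for h k s
    proof -
      have "r * h x \<le> r * k x" using that xS by (auto simp: \<phi>_def split: if_splits)
      then show ?thesis using x by simp
    qed
    obtain s s' where "s \<in> S" "f s = 0" "s' \<in> S" "g s' = 0" using \<phi>[OF f] \<phi>[OF g] by blast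
    moreover have "0 \<le> f s'" "0 \<le> g s" using f g by (auto simp: realization_def)
    ultimately have "f x = g x" using le[of s f g] le[of s' g f] eq by (simp add: order_antisym)
    then show "f = g" using eq by (force simp: \<phi>_def fun_eq_iff split: if_splits)
  qed
  show "lincomb ` realization (stellar S x \<B>) = lincomb ` realization \<B>"
  proof
    show "lincomb ` realization (stellar S x \<B>) \<subseteq> lincomb ` realization \<B>"
      using \<phi> by (metis image_subsetI imageI)
    show "lincomb ` realization \<B> \<subseteq> lincomb ` realization (stellar S x \<B>)"
    proof safe
      fix g assume g: "g \<in> realization \<B>"
      then obtain B where B: "B \<in> \<B>" "{b. g b \<noteq> 0} \<subseteq> B" and nn: "\<And>b. 0 \<le> g b"
        by (auto simp: realization_def)
      show "lincomb g \<in> lincomb ` realization (stellar S x \<B>)"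
      proof (cases "S \<subseteq> B")
        case False
        then have "g \<in> realization (stellar S x \<B>)"
          using B nn by (auto simp: realization_def stellar_def)
        then show ?thesis by blast
      next
        case True
        have "Min (g ` S) \<in> g ` S" using S fS by (intro Min_in) auto
        then obtain s where s: "s \<in> S" "g s = Min (g ` S)" by auto
        have le: "g s \<le> g b" if "b \<in> S" for b using s that fS by simp
        \<comment> \<open>The inverse of \<open>\<phi>\<close>: the largest amount that can be
          removed equally from all of \<open>S\<close> is moved to \<open>x\<close>. It is the
          minimum, attained at \<open>s\<close>, so the coefficient of \<open>s\<close> becomes 0
          and the support fits the cell without \<open>s\<close>.\<close>
        define f where "f = (\<lambda>b. if b = x then g s / r else g b - (if b \<in> S then g s else 0))"
        have gx: "g x = 0" using B x by auto
        have supp: "{b. f b \<noteq> 0} \<subseteq> insert x (B - {s})"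
          using B True s by (auto simp: f_def split: if_splits)
        have "insert x (B - {s}) \<in> stellar S x \<B>"
          using B s True by (auto simp: stellar_def)
        moreover have "0 \<le> f b" for b
          using nn le[of b] x(2) by (simp add: f_def)
        ultimately have "f \<in> realization (stellar S x \<B>)"
          using supp by (auto simp: realization_def)
        moreover have "\<phi> f = g"
          using gx xS x(2) by (simp add: f_def \<phi>_def fun_eq_iff)
        moreover have "lincomb (\<phi> f) = lincomb f" using supp True B by (intro lin[of B]) auto
        ultimately show ?thesis by (metis imageI)
      qed
    qed
  qed
qed

section \<open>Multiplicity and unimodular cones\<close>

lemma sum_delta_scaleR:
  fixes u :: "'n::finite \<Rightarrow> 'a::real_vector"
  shows "(\<Sum>i\<in>UNIV. (if i = k then c else 0) *\<^sub>R u i) = c *\<^sub>R u k"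
proof -
  have "(if i = k then c else 0) *\<^sub>R u i = (if i = k then c *\<^sub>R u k else 0)" for i by simp
  then show ?thesis by simp
qed

lemma cone_multiplicity_eq_det_rows:
  fixes w :: "'n::finite \<Rightarrow> real^'n"
  shows "cone_multiplicity w = \<bar>det (\<chi> i. w i)\<bar>"
proof -
  have "(\<chi> i j. w j $ i) = transpose (\<chi> i. w i)" by (simp add: transpose_def)
  then show ?thesis by (simp add: cone_multiplicity_def det_transpose)
qed

lemma cone_multiplicity_Ints:
  fixes w :: "'n::finite \<Rightarrow> real^'n"
  assumes "\<And>i. lattice_point (w i)"
  shows "cone_multiplicity w \<in> \<int>"
  using assms unfolding cone_multiplicity_def det_def lattice_point_def
  by (auto intro!: Ints_abs Ints_sum Ints_mult Ints_prod)

text \<open>Cramer's rule. It yields both the halving of multiplicities and the integrality of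
  coordinates in unimodular cones.\<close>

lemma cone_multiplicity_upd_sum:
  fixes w :: "'n::finite \<Rightarrow> real^'n"
  shows "cone_multiplicity (w(k := \<Sum>i\<in>UNIV. a i *\<^sub>R w i)) = \<bar>a k\<bar> * cone_multiplicity w"
proof -
  have "(\<chi> i. (w(k := \<Sum>i\<in>UNIV. a i *\<^sub>R w i)) i) =
    (\<chi> i. if i = k then sum (\<lambda>i. (\<chi> i. a i) $ i *s row i (\<chi> i. w i)) UNIV else row i (\<chi> i. w i))"
    by (simp add: vec_eq_iff row_def scalar_mult_eq_scaleR)
  then show ?thesis
    unfolding cone_multiplicity_eq_det_rows by (simp only: cramer_lemma_transpose) (simp add: abs_mult)
qed

lemma inj_if_cone_multiplicity:
  fixes w :: "'n::finite \<Rightarrow> real^'n"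
  assumes "cone_multiplicity w \<noteq> 0"
  shows "inj w"
proof (rule injI, rule ccontr)
  fix i j assume "w i = w j" "i \<noteq> j"
  then have "det (\<chi> i. w i) = 0" by (intro det_identical_rows[of i j]) (auto simp: row_def)
  then show False using assms by (simp add: cone_multiplicity_eq_det_rows)
qed

lemma independent_if_cone_multiplicity:
  fixes w :: "'n::finite \<Rightarrow> real^'n"
  assumes "cone_multiplicity w \<noteq> 0"
  shows "independent (range w)"
proof
  assume "dependent (range w)"
  moreover have "rows (\<chi> i. w i) = range w" by (auto simp: rows_def row_def)
  ultimately have "det (\<chi> i. w i) = 0"
    by (intro det_dependent_rows) (simp add: dependent_vec_eq)
  then show False using assms by (simp add: cone_multiplicity_eq_det_rows)
qed

text \<open>This makes a single simplicial cone a triangulation of itself, and makes the cones over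
  subsets of its generators faces.\<close>

lemma inj_on_lincomb_independent:
  assumes "independent B" "finite B"
  shows "inj_on lincomb (realization {B})"
proof (rule inj_onI)
  fix f g assume f: "f \<in> realization {B}" and g: "g \<in> realization {B}" and eq: "lincomb f = lincomb g"
  have "(\<Sum>b\<in>B. (f b - g b) *\<^sub>R b) = lincomb f - lincomb g"
    using f g assms lincomb_eq_sum[of B f] lincomb_eq_sum[of B g]
    by (simp add: realization_def scaleR_diff_left sum_subtractf)
  then have "f b - g b = 0" if "b \<in> B" for b
    using that eq assms by (intro independentD[of B B]) auto
  moreover have "f b = 0" "g b = 0" if "b \<notin> B" for b using that f g by (auto simp: realization_def)
  ultimately show "f = g" by (metis eq_iff_diff_eq_0 ext)
qed

text \<open>Moves coefficients from vectors to indices; injectivity of \<open>w\<close> makes the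
  two kinds interchangeable.\<close>

lemma convex_cone_hull_range_iff:
  fixes w :: "'n::finite \<Rightarrow> 'a::real_vector"
  assumes "inj w"
  shows "x \<in> convex_cone hull (range w) \<longleftrightarrow> (\<exists>a. (\<forall>i. 0 \<le> a i) \<and> x = (\<Sum>i\<in>UNIV. a i *\<^sub>R w i))"
proof -
  have eq: "lincomb f = (\<Sum>i\<in>UNIV. f (w i) *\<^sub>R w i)" if "f \<in> realization {range w}" for f
    using that lincomb_eq_sum[of "range w" f] sum.reindex[OF assms, of "\<lambda>b. f b *\<^sub>R b"]
    by (simp add: realization_def)
  show ?thesis
  proof
    assume "x \<in> convex_cone hull (range w)"
    then obtain f where "f \<in> realization {range w}" "x = lincomb f"
      by (auto simp: convex_cone_hull_finite)
    then show "\<exists>a. (\<forall>i. 0 \<le> a i) \<and> x = (\<Sum>i\<in>UNIV. a i *\<^sub>R w i)"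
      by (intro exI[of _ "\<lambda>i. f (w i)"]) (auto simp: eq realization_def)
  next
    assume "\<exists>a. (\<forall>i. 0 \<le> a i) \<and> x = (\<Sum>i\<in>UNIV. a i *\<^sub>R w i)"
    then obtain a where a: "\<And>i. 0 \<le> a i" "x = (\<Sum>i\<in>UNIV. a i *\<^sub>R w i)" by auto
    define f where "f = (\<lambda>b. if b \<in> range w then a (inv w b) else 0)"
    have f: "f \<in> realization {range w}" using a by (auto simp: f_def realization_def)
    moreover have "x = lincomb f" using a assms by (simp add: eq[OF f]) (simp add: f_def)
    ultimately show "x \<in> convex_cone hull (range w)" by (simp add: convex_cone_hull_finite)
  qed
qed

lemma lattice_point_diff: "lattice_point x \<Longrightarrow> lattice_point y \<Longrightarrow> lattice_point (x - y)"
  by (simp add: lattice_point_def)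

section \<open>Determinants modulo 2 and half sums of generators\<close>

lemma det_of_int:
  fixes Z :: "'n::finite \<Rightarrow> 'n \<Rightarrow> int"
  shows "det (\<chi> i j. of_int (Z i j)) = (of_int (det (\<chi> i j. Z i j)) :: 'a::comm_ring_1)"
  by (simp add: det_def)

lemma of_int_bit_eq_0_iff: "(of_int k :: bit) = 0 \<longleftrightarrow> even k"
proof (cases "even k")
  case False
  then obtain m where "k = 2 * m + 1" by (elim oddE)
  with False show ?thesis by simp
qed auto

text \<open>Over the field with two elements an integer matrix of even determinant has linearly
  dependent rows.\<close>

lemma even_cone_multiplicity_half_sum:
  fixes w :: "'n::finite \<Rightarrow> real^'n"
  assumes "\<And>i. lattice_point (w i)" and "cone_multiplicity w = of_int (2 * m)"
  obtains I where "I \<noteq> {}" "lattice_point ((1 / 2) *\<^sub>R (\<Sum>i\<in>I. w i))"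
proof -
  have "\<forall>i j. \<exists>z. w i $ j = of_int z"
    using assms(1) unfolding lattice_point_def by (meson Ints_cases)
  then obtain Z where Z: "\<And>i j. w i $ j = of_int (Z i j)" by metis
  have "(\<chi> i. w i) = (\<chi> i j. of_int (Z i j))" by (simp add: vec_eq_iff Z)
  then have "\<bar>of_int (det (\<chi> i j. Z i j))\<bar> = (of_int (2 * m) :: real)"
    using assms(2) by (simp add: cone_multiplicity_eq_det_rows det_of_int)
  then have "\<bar>det (\<chi> i j. Z i j)\<bar> = 2 * m" by linarith
  then have "even (det (\<chi> i j. Z i j))" by (metis dvd_abs_iff dvd_triv_left)
  then have "det (\<chi> i j. of_int (Z i j)) = (0 :: bit)"
    unfolding det_of_int of_int_bit_eq_0_iff .
  \<comment> \<open>A singular matrix over a field has no right inverse, which is equivalent to a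
    nontrivial relation \<open>c\<close> among its rows.\<close>
  then have "\<not> (\<exists>B. ((\<chi> i j. of_int (Z i j)) :: bit^'n^'n) ** B = mat 1)"
    using invertible_det_nz invertible_right_inverse by metis
  then obtain c :: "'n \<Rightarrow> bit" and i0 where
    c: "(\<Sum>i\<in>UNIV. c i *s row i (\<chi> i j. of_int (Z i j))) = 0" "c i0 \<noteq> 0"
    unfolding matrix_right_invertible_independent_rows by blast
  \<comment> \<open>The only nonzero scalar in \<open>bit\<close> is 1, so the relation says that
    the rows indexed by \<open>I\<close> sum to zero modulo 2.\<close>
  define I where "I = {i. c i \<noteq> 0}"
  have "lattice_point ((1 / 2) *\<^sub>R (\<Sum>i\<in>I. w i))"
    unfolding lattice_point_def
  proof
    fix j
    have "of_int (\<Sum>i\<in>I. Z i j) = (\<Sum>i\<in>UNIV. c i * of_int (Z i j))"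
      unfolding of_int_sum I_def by (rule sum.mono_neutral_cong_left) auto
    also have "\<dots> = 0" using arg_cong[OF c(1), of "\<lambda>x. x $ j"] by (simp add: row_def)
    finally have "even (\<Sum>i\<in>I. Z i j)" unfolding of_int_bit_eq_0_iff .
    then obtain n where "(\<Sum>i\<in>I. Z i j) = 2 * n" by blast
    then have "(\<Sum>i\<in>I. w i $ j) = of_int (2 * n)" by (simp only: Z flip: of_int_sum)
    then show "((1 / 2) *\<^sub>R (\<Sum>i\<in>I. w i)) $ j \<in> \<int>" by simp
  qed
  moreover have "I \<noteq> {}" using c by (auto simp: I_def)
  ultimately show ?thesis using that by blast
qed

section \<open>Lattice points and extreme generators of unimodular cones\<close>

text \<open>Replacing \<open>w k\<close> by the given lattice point produces an integral matrix
  whose multiplicity is the absolute value of \<open>a k\<close>, by Cramer's rule.\<close>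

lemma unimodular_coords_Nats:
  fixes w :: "'n::finite \<Rightarrow> real^'n"
  assumes "\<And>i. lattice_point (w i)" "cone_multiplicity w = 1"
    and "lattice_point (\<Sum>i\<in>UNIV. a i *\<^sub>R w i)" "0 \<le> a k"
  obtains m :: nat where "a k = real m"
proof -
  have "cone_multiplicity (w(k := \<Sum>i\<in>UNIV. a i *\<^sub>R w i)) \<in> \<int>"
    using assms by (intro cone_multiplicity_Ints) auto
  then have "a k \<in> \<nat>"
    using assms by (simp add: cone_multiplicity_upd_sum Nats_altdef2)
  then show ?thesis using that by (auto elim: Nats_cases)
qed

text \<open>A factor \<open>m\<close> of \<open>w k\<close> can be pulled out of the determinant,
  which exhibits 1 as \<open>m\<close> times an integer.\<close>

lemma unimodular_generator_primitive:
  fixes w :: "'n::finite \<Rightarrow> real^'n"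
  assumes "\<And>i. lattice_point (w i)" "cone_multiplicity w = 1"
  shows "primitive (w k)"
  unfolding primitive_def
proof (intro conjI allI impI)
  show "lattice_point (w k)" by fact
  show "w k \<noteq> 0"
    using independent_if_cone_multiplicity[of w] assms(2) dependent_zero[of "range w"]
    by (metis range_eqI zero_neq_one)
  fix m :: nat and y assume y: "lattice_point y \<and> w k = real m *\<^sub>R y"
  define u where "u = w(k := y)"
  have "w = u(k := \<Sum>i\<in>UNIV. (if i = k then real m else 0) *\<^sub>R u i)"
    using y unfolding sum_delta_scaleR by (auto simp: u_def fun_eq_iff)
  then have "1 = real m * cone_multiplicity u"
    using cone_multiplicity_upd_sum[of u k "\<lambda>i. if i = k then real m else 0"] assms(2) by simp
  moreover have "cone_multiplicity u \<in> \<int>"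
    using assms y by (intro cone_multiplicity_Ints) (auto simp: u_def)
  then obtain z where "cone_multiplicity u = of_int z" by (elim Ints_cases)
  ultimately have "real_of_int (int m * z) = real_of_int 1" by simp
  then have "int m * z = 1" by (simp only: of_int_eq_iff)
  then show "m = 1" by (auto simp: zmult_eq_1_iff)
qed

lemma mem_convex_cone_hull_sing: "x \<in> convex_cone hull {y} \<longleftrightarrow> (\<exists>c\<ge>0. x = c *\<^sub>R y)"
  for x y :: "'a::real_vector"
  using convex_cone_hull_range_iff[of "\<lambda>_::unit. y" x] by (auto simp: inj_def UNIV_unit)

text \<open>The midpoint of \<open>a\<close> and \<open>b\<close> lies in \<open>F\<close> because
  \<open>F\<close> is a cone, and the face property applies to it. For \<open>a = b\<close> the open
  segment is empty, but then the midpoint is \<open>a\<close> itself.\<close>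

lemma face_of_cone_summand:
  assumes F: "F face_of D" "convex_cone D" "convex_cone F" and "a \<in> D" "b \<in> D" "a + b \<in> F"
  shows "a \<in> F"
proof (cases "a = b")
  case True
  then have "(1 / 2) *\<^sub>R (a + b) = a" by (simp flip: scaleR_2)
  then show ?thesis using assms convex_cone_scaleR[of F "1/2" "a + b"] by simp
next
  case False
  have "(1 / 2) *\<^sub>R (a + b) \<in> F" using assms convex_cone_scaleR[of F "1/2" "a + b"] by simp
  moreover have "(1 / 2) *\<^sub>R (a + b) \<in> open_segment a b"
    using False by (auto simp: in_segment scaleR_add_right intro!: exI[of _ "1/2"])
  ultimately show ?thesis using assms unfolding face_of_def by blast
qed

text \<open>The substance is that the generators are exactly the extreme integral ones. Each is
  primitive and spans a face; conversely a primitive vector spanning an extreme ray must be a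
  multiple of some generator, with factor 1.\<close>

lemma simplicial_cone_unimodular:
  fixes w :: "'n::finite \<Rightarrow> real^'n"
  assumes lat: "\<And>i. lattice_point (w i)" and mult: "cone_multiplicity w = 1"
  shows "simplicial_cone w (convex_cone hull (range w))"
  unfolding simplicial_cone_def
proof (intro conjI refl)
  show inj: "inj w" using mult by (simp add: inj_if_cone_multiplicity)
  show indep: "independent (range w)" using mult by (simp add: independent_if_cone_multiplicity)
  have w0: "w i \<noteq> 0" for i using unimodular_generator_primitive[OF lat mult, of i] by (simp add: primitive_def)
  show "range w = extreme_integral_generators (convex_cone hull (range w))"
  proof
    show "range w \<subseteq> extreme_integral_generators (convex_cone hull (range w))"
      using unimodular_generator_primitive[OF lat mult] inj_on_lincomb_independent[OF indep]
      by (auto simp: extreme_integral_generators_def intro: face_of_convex_cone_hull_subset)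
    show "extreme_integral_generators (convex_cone hull (range w)) \<subseteq> range w"
    proof
      fix x assume "x \<in> extreme_integral_generators (convex_cone hull (range w))"
      then have x: "primitive x" and face: "(convex_cone hull {x}) face_of (convex_cone hull (range w))"
        by (auto simp: extreme_integral_generators_def)
      have xr: "x \<in> convex_cone hull {x}" by (simp add: hull_inc)
      then have "x \<in> convex_cone hull (range w)" using face face_of_imp_subset by blast
      then obtain a where a: "\<And>i. 0 \<le> a i" "x = (\<Sum>i\<in>UNIV. a i *\<^sub>R w i)"
        using convex_cone_hull_range_iff[OF inj] by auto
      obtain i where i: "a i \<noteq> 0" using a x by (force simp: primitive_def)
      \<comment> \<open>Splitting off one term with nonzero coefficient leaves two summands in the
        cone, and the face property puts the first one on the ray of \<open>x\<close>.\<close>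
      define b where "b = (\<Sum>j\<in>UNIV - {i}. a j *\<^sub>R w j)"
      have "b = (\<Sum>j\<in>UNIV. (if j = i then 0 else a j) *\<^sub>R w j)"
        unfolding b_def by (rule sum.mono_neutral_cong_left) auto
      then have b: "b \<in> convex_cone hull (range w)"
        using a(1) unfolding convex_cone_hull_range_iff[OF inj] by (intro exI[of _ "\<lambda>j. if j = i then 0 else a j"]) simp
      have xb: "x = a i *\<^sub>R w i + b" unfolding a(2) b_def by (rule sum.remove) auto
      have "a i *\<^sub>R w i \<in> convex_cone hull (range w)"
        using a by (simp add: convex_cone_hull_mul hull_inc)
      then have "a i *\<^sub>R w i \<in> convex_cone hull {x}"
        using xr[unfolded xb] b face_of_cone_summand[OF face] convex_cone_convex_cone_hull
        unfolding xb by blast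
      then obtain c where c: "c \<ge> 0" "a i *\<^sub>R w i = c *\<^sub>R x"
        using mem_convex_cone_hull_sing by blast
      have "c \<noteq> 0" using c i w0 by auto
      have "x = (1 / c) *\<^sub>R (c *\<^sub>R x)" using \<open>c \<noteq> 0\<close> by simp
      also have "\<dots> = (a i / c) *\<^sub>R w i" by (simp flip: c(2))
      finally have xw: "x = (a i / c) *\<^sub>R w i" .
      \<comment> \<open>Unimodularity makes the factor a natural number; primitivity of
        \<open>x\<close> then makes it 1.\<close>
      then have "x = (\<Sum>j\<in>UNIV. (if j = i then a i / c else 0) *\<^sub>R w j)"
        by (simp only: sum_delta_scaleR)
      then obtain m :: nat where "a i / c = real m"
        using unimodular_coords_Nats[OF lat mult, of "\<lambda>j. if j = i then a i / c else 0" i] x a c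
        by (auto simp: primitive_def)
      then have "a i / c = 1" using xw x lat[of i] unfolding primitive_def by auto
      then show "x \<in> range w" using xw by simp
    qed
  qed
qed

text \<open>A nonzero coefficient of a lattice point is a natural number, hence at least 1. That
  generator can be subtracted without leaving the cone, and irreducibility leaves nothing
  else.\<close>

lemma hilbert_basis_unimodular:
  fixes w :: "'n::finite \<Rightarrow> real^'n"
  assumes lat: "\<And>i. lattice_point (w i)" and mult: "cone_multiplicity w = 1"
  shows "hilbert_basis (convex_cone hull (range w)) \<subseteq> range w"
proof
  fix x assume "x \<in> hilbert_basis (convex_cone hull (range w))"
  then have x: "x \<in> convex_cone hull (range w)" "lattice_point x" "x \<noteq> 0"
    and irred: "\<And>y z. \<lbrakk>y \<in> convex_cone hull (range w); lattice_point y;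
      z \<in> convex_cone hull (range w); lattice_point z; x = y + z\<rbrakk> \<Longrightarrow> y = 0 \<or> z = 0"
    by (auto simp: hilbert_basis_def)
  have inj: "inj w" using mult by (simp add: inj_if_cone_multiplicity)
  obtain a where a: "\<And>i. 0 \<le> a i" "x = (\<Sum>i\<in>UNIV. a i *\<^sub>R w i)"
    using x convex_cone_hull_range_iff[OF inj] by auto
  obtain i where i: "a i \<noteq> 0" using a x by force
  obtain m :: nat where "a i = real m"
    using unimodular_coords_Nats[OF lat mult, of a i] a x by auto
  then have ai: "1 \<le> a i" using i by simp
  have "x - w i = (\<Sum>j\<in>UNIV. (a j - (if j = i then 1 else 0)) *\<^sub>R w j)"
    using a by (simp add: scaleR_diff_left sum_subtractf sum_delta_scaleR)
  then have "x - w i \<in> convex_cone hull (range w)"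
    using a ai by (subst convex_cone_hull_range_iff[OF inj]) (intro exI conjI, auto)
  then have "w i = 0 \<or> x - w i = 0"
    using x lat by (intro irred) (auto simp: hull_inc lattice_point_diff)
  moreover have "w i \<noteq> 0" using unimodular_generator_primitive[OF lat mult, of i] by (simp add: primitive_def)
  ultimately show "x \<in> range w" by simp
qed

section \<open>Halving the multiplicity by short vectors\<close>

text \<open>Maximal cones are stored as indexed generator families rather than as sets, so that
  their determinants are at hand.\<close>

definition triangulates :: "('n::finite \<Rightarrow> real^'n) set \<Rightarrow> (real^'n) set \<Rightarrow> bool" where
  "triangulates G C \<longleftrightarrow> finite G \<and> (\<forall>w\<in>G. inj w \<and> (\<forall>i. lattice_point (w i))) \<and>
     inj_on lincomb (realization (range ` G)) \<and> lincomb ` realization (range ` G) = C"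

text \<open>The indexed form of \<open>stellar\<close>: \<open>x\<close> takes over the index of the
  generator it replaces, as \<open>cone_multiplicity_upd_sum\<close> requires.\<close>

definition subdivide :: "'a set \<Rightarrow> 'a \<Rightarrow> ('n \<Rightarrow> 'a) set \<Rightarrow> ('n \<Rightarrow> 'a) set" where
  "subdivide S x G = {w \<in> G. \<not> S \<subseteq> range w} \<union>
     {w(i := x) | w i. w \<in> G \<and> S \<subseteq> range w \<and> w i \<in> S}"

lemma range_upd_inj: "inj w \<Longrightarrow> range (w(i := x)) = insert x (range w - {w i})"
  by (auto simp: inj_def image_iff)

lemma range_subdivide:
  assumes "\<And>w. w \<in> G \<Longrightarrow> inj w"
  shows "range ` subdivide S x G = stellar S x (range ` G)"
proof
  show "range ` subdivide S x G \<subseteq> stellar S x (range ` G)"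
    using assms by (auto simp: subdivide_def stellar_def range_upd_inj simp del: fun_upd_apply)
  show "stellar S x (range ` G) \<subseteq> range ` subdivide S x G"
  proof
    fix B assume "B \<in> stellar S x (range ` G)"
    then consider w where "w \<in> G" "\<not> S \<subseteq> range w" "B = range w"
      | w i where "w \<in> G" "S \<subseteq> range w" "w i \<in> S" "B = insert x (range w - {w i})"
      unfolding stellar_def by blast
    then show "B \<in> range ` subdivide S x G"
    proof cases
      case 1
      then show ?thesis by (auto simp: subdivide_def)
    next
      case 2
      then have "w(i := x) \<in> subdivide S x G" "B = range (w(i := x))"
        using assms by (auto simp: subdivide_def range_upd_inj simp del: fun_upd_apply)
      then show ?thesis by blast
    qed
  qed
qed

lemma triangulates_subdivide:
  fixes G :: "('n::finite \<Rightarrow> real^'n) set"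
  assumes T: "triangulates G C" and w0: "w0 \<in> G" "S \<subseteq> range w0" "S \<noteq> {}"
    and x: "x = (1 / 2) *\<^sub>R \<Sum>S" "lattice_point x"
  shows "triangulates (subdivide S x G) C"
proof -
  have T': "finite G" "\<And>w. w \<in> G \<Longrightarrow> inj w" "\<And>w i. w \<in> G \<Longrightarrow> lattice_point (w i)"
    "inj_on lincomb (realization (range ` G))" "lincomb ` realization (range ` G) = C"
    using T by (auto simp: triangulates_def)
  have fS: "finite S" using w0(2) by (rule finite_subset) simp
  \<comment> \<open>If \<open>x\<close> were already a generator, it would have two coefficient
    functions: weight 1/2 on \<open>S\<close>, and weight 1 at \<open>x\<close>. They differ at
    \<open>x\<close>.\<close>
  have xG: "x \<notin> \<Union>(range ` G)"
  proof
    assume xG: "x \<in> \<Union>(range ` G)"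
    define f g where "f = (\<lambda>b. if b \<in> S then 1 / 2 else 0 :: real)"
      and "g = (\<lambda>b. if b = x then 1 else 0 :: real)"
    have "lincomb f = (\<Sum>b\<in>S. f b *\<^sub>R b)"
      using fS by (intro lincomb_eq_sum) (auto simp: f_def)
    also have "\<dots> = x" by (simp add: x f_def scaleR_sum_right)
    also have "x = lincomb g" by (simp add: lincomb_def g_def)
    finally have "lincomb f = lincomb g" .
    moreover have "f \<in> realization (range ` G)" "g \<in> realization (range ` G)"
      using w0 xG by (auto simp: realization_def f_def g_def)
    ultimately have "f x = g x" using T'(4) by (metis inj_onD)
    then show False by (simp add: f_def g_def split: if_splits)
  qed
  have st: "range ` subdivide S x G = stellar S x (range ` G)"
    using T' by (intro range_subdivide)
  have "range w0 \<in> range ` G" using w0 by simp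
  moreover have "finite B" if "B \<in> range ` G" for B using that by auto
  ultimately have "inj_on lincomb (realization (stellar S x (range ` G)))"
    "lincomb ` realization (stellar S x (range ` G)) = lincomb ` realization (range ` G)"
    using stellar_lincomb[OF _ T'(4) w0(3,2) _ x(1) _ xG] by simp_all
  moreover have "finite (subdivide S x G)"
  proof -
    have "subdivide S x G \<subseteq> G \<union> (\<lambda>(w, i). w(i := x)) ` (G \<times> UNIV)"
      by (auto simp: subdivide_def)
    then show ?thesis by (rule finite_subset) (use T'(1) in auto)
  qed
  moreover have "inj u \<and> (\<forall>i. lattice_point (u i))" if u: "u \<in> subdivide S x G" for u
  proof -
    from u consider "u \<in> G" | w i where "w \<in> G" "u = w(i := x)" by (auto simp: subdivide_def)
    then show ?thesis
    proof cases
      case 2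
      moreover have "x \<notin> range w" using xG 2 by blast
      then have "inj (w(i := x))" using T' 2 by (auto simp: inj_def image_iff)
      ultimately show ?thesis using T' x by auto
    qed (use T' in auto)
  qed
  ultimately show ?thesis using T' by (auto simp: triangulates_def st)
qed

text \<open>The witness \<open>k\<close> counts the subdivisions that led to the cone.\<close>

definition short :: "(real^'n::finite \<Rightarrow> real) \<Rightarrow> nat \<Rightarrow> ('n \<Rightarrow> real^'n) \<Rightarrow> bool" where
  "short L l w \<longleftrightarrow> (\<exists>k. cone_multiplicity w * 2 ^ k = 2 ^ l \<and>
     (\<forall>i. 0 \<le> L (w i) \<and> L (w i) \<le> real CARD('n) / 2 * (3 / 2) ^ k) \<and>
     (\<Sum>i\<in>UNIV. L (w i)) \<le> real CARD('n) * (3 / 2) ^ k)"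

text \<open>In terms of the family \<open>w\<close>, the vector \<open>x\<close> has coefficient 1/2
  at each index whose generator lies in \<open>S\<close>, in particular at \<open>i\<close>.\<close>

lemma cone_multiplicity_half_sum:
  fixes w :: "'n::finite \<Rightarrow> real^'n"
  assumes "inj w" "S \<subseteq> range w" "w i \<in> S" "x = (1 / 2) *\<^sub>R \<Sum>S"
  shows "cone_multiplicity (w(i := x)) = cone_multiplicity w / 2"
    and "linear (L :: real^'n \<Rightarrow> real) \<Longrightarrow> L x = (\<Sum>j | w j \<in> S. L (w j)) / 2"
proof -
  have S: "S = w ` {j. w j \<in> S}" using assms by auto
  have sum: "\<Sum>S = (\<Sum>j | w j \<in> S. w j)"
    by (subst S, subst sum.reindex) (use assms in \<open>auto intro: inj_on_subset\<close>)
  have "x = (\<Sum>j\<in>UNIV. (if w j \<in> S then 1 / 2 else 0) *\<^sub>R w j)"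
    unfolding assms(4) sum scaleR_sum_right by (rule sum.mono_neutral_cong_left) auto
  then show "cone_multiplicity (w(i := x)) = cone_multiplicity w / 2"
    using assms cone_multiplicity_upd_sum[of w i "\<lambda>j. if w j \<in> S then 1 / 2 else 0"] by simp
  show "L x = (\<Sum>j | w j \<in> S. L (w j)) / 2" if "linear L"
    unfolding assms(4) sum using that by (simp add: linear_scale linear_sum flip: sum_divide_distrib)
qed

text \<open>The count grows to \<open>k + 1\<close>, which absorbs the halved multiplicity. The old
  bound on the sum bounds \<open>L x\<close> by half of it, and the discarded value
  \<open>L (w i)\<close> is nonnegative, so the new sum exceeds the old bound by at most its
  half.\<close>

lemma short_half_sum:
  fixes w :: "'n::finite \<Rightarrow> real^'n"
  assumes L: "linear L" and "short L l w"
    and w: "inj w" "S \<subseteq> range w" "w i \<in> S" "x = (1 / 2) *\<^sub>R \<Sum>S"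
  shows "short L l (w(i := x))"
proof -
  obtain k where k: "cone_multiplicity w * 2 ^ k = 2 ^ l" "\<And>i. 0 \<le> L (w i)"
    "\<And>i. L (w i) \<le> real CARD('n) / 2 * (3 / 2) ^ k"
    "(\<Sum>i\<in>UNIV. L (w i)) \<le> real CARD('n) * (3 / 2) ^ k"
    using assms(2) by (auto simp: short_def)
  note Lx = cone_multiplicity_half_sum(2)[OF w L]
  have pos: "0 \<le> L x" using k by (simp add: Lx sum_nonneg)
  have "(\<Sum>j | w j \<in> S. L (w j)) \<le> (\<Sum>j\<in>UNIV. L (w j))"
    using k by (intro sum_mono2) auto
  then have le: "L x \<le> real CARD('n) / 2 * (3 / 2) ^ k" using k(4) by (simp add: Lx)
  have mono: "real CARD('n) / 2 * (3 / 2) ^ k \<le> real CARD('n) / 2 * (3 / 2) ^ Suc k"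
    by (intro mult_left_mono power_increasing) auto
  have "(\<Sum>j\<in>UNIV. L ((w(i := x)) j)) = L x + (\<Sum>j\<in>UNIV - {i}. L (w j))"
    by (subst sum.remove[of UNIV i]) auto
  also have "\<dots> \<le> L x + (\<Sum>j\<in>UNIV. L (w j))"
    using k by (intro add_left_mono sum_mono2) auto
  also have "\<dots> \<le> real CARD('n) * (3 / 2) ^ Suc k" using le k(4) by simp
  finally have "(\<Sum>j\<in>UNIV. L ((w(i := x)) j)) \<le> real CARD('n) * (3 / 2) ^ Suc k" .
  moreover have "L ((w(i := x)) j) \<le> real CARD('n) / 2 * (3 / 2) ^ Suc k" for j
    using order_trans[OF le mono] order_trans[OF k(3)[of j] mono] by auto
  ultimately show ?thesis
    unfolding short_def cone_multiplicity_half_sum(1)[OF w] using k(1,2) pos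
    by (intro exI[of _ "Suc k"]) auto
qed

text \<open>Induction on the number of cones with multiplicity above \<open>2 ^ M\<close>. A
  subdivision brings every affected cone down to at most \<open>2 ^ M\<close> and leaves the others
  as they are.\<close>

lemma reduce_multiplicity:
  fixes G :: "('n::finite \<Rightarrow> real^'n) set"
  assumes L: "linear L" and "triangulates G C" "\<And>w. w \<in> G \<Longrightarrow> short L l w"
    and "\<And>w. w \<in> G \<Longrightarrow> cone_multiplicity w \<le> 2 ^ Suc M"
  shows "\<exists>G'. triangulates G' C \<and> (\<forall>w\<in>G'. short L l w \<and> cone_multiplicity w \<le> 2 ^ M)"
  using assms(2-)
proof (induction "card {w \<in> G. cone_multiplicity w > 2 ^ M}" arbitrary: G rule: less_induct)
  case less
  show ?case
  proof (cases "\<forall>w\<in>G. cone_multiplicity w \<le> 2 ^ M")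
    case True
    then show ?thesis using less.prems by blast
  next
    case False
    then obtain w where w: "w \<in> G" "cone_multiplicity w > 2 ^ M" by force
    have T: "finite G" "\<And>w. w \<in> G \<Longrightarrow> inj w" "\<And>w i. w \<in> G \<Longrightarrow> lattice_point (w i)"
      using less.prems(1) by (auto simp: triangulates_def)
    obtain k where k: "cone_multiplicity w * 2 ^ k = 2 ^ l"
      using less.prems(2)[OF w(1)] by (auto simp: short_def)
    \<comment> \<open>By \<open>short\<close> the multiplicity is a power of two; exceeding 1, it is
      even, so a half sum of generators is a lattice point.\<close>
    have "1 < cone_multiplicity w" using w(2) one_le_power[of "2::real" M] by linarith
    then have "1 * 2 ^ k < (2::real) ^ l" unfolding k[symmetric] by (intro mult_strict_right_mono) auto
    then have "k < l" by simp
    then obtain m where "l = k + Suc m" using less_imp_Suc_add by fastforce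
    then have "cone_multiplicity w = of_int (2 * 2 ^ m)"
      using k by (simp add: power_add)
    then obtain I where I: "I \<noteq> {}" "lattice_point ((1 / 2) *\<^sub>R (\<Sum>i\<in>I. w i))"
      using even_cone_multiplicity_half_sum[of w "2 ^ m"] T w by metis
    define S x where "S = w ` I" and "x = (1 / 2) *\<^sub>R \<Sum>S"
    have "\<Sum>S = (\<Sum>i\<in>I. w i)"
      unfolding S_def using T(2)[OF w(1)] by (subst sum.reindex) (auto intro: inj_on_subset)
    then have lat: "lattice_point x" using I by (simp add: x_def)
    have S: "S \<subseteq> range w" "S \<noteq> {}" using I by (auto simp: S_def)
    define H where "H = subdivide S x G"
    have H: "triangulates H C"
      unfolding H_def using less.prems(1) w(1) S x_def lat by (rule triangulates_subdivide)
    have cases: "u \<in> G \<and> \<not> S \<subseteq> range u \<or>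
      (short L l u \<and> cone_multiplicity u \<le> 2 ^ M)" if u: "u \<in> H" for u
      using u unfolding H_def subdivide_def
    proof (elim UnE CollectE exE conjE)
      fix w' i assume w': "u = w'(i := x)" "w' \<in> G" "S \<subseteq> range w'" "w' i \<in> S"
      then have "short L l u" "cone_multiplicity u = cone_multiplicity w' / 2"
        unfolding w'(1)
        using short_half_sum[OF L less.prems(2)] cone_multiplicity_half_sum(1) T(2) w' x_def by blast+
      then show ?thesis using less.prems(3)[OF w'(2)] by simp
    qed simp
    \<comment> \<open>The inclusion is strict because \<open>w\<close> contains \<open>S\<close> and
      therefore drops out.\<close>
    have "{u \<in> H. cone_multiplicity u > 2 ^ M} \<subset> {u \<in> G. cone_multiplicity u > 2 ^ M}"
      using cases w S by fastforce
    then have "card {u \<in> H. cone_multiplicity u > 2 ^ M} < card {u \<in> G. cone_multiplicity u > 2 ^ M}"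
      using T by (intro psubset_card_mono) auto
    moreover have "short L l u" if "u \<in> H" for u using cases[OF that] less.prems(2) by blast
    moreover have "cone_multiplicity u \<le> 2 ^ Suc M" if "u \<in> H" for u
    proof -
      have "(2::real) ^ M \<le> 2 ^ Suc M" by simp
      then show ?thesis using cases[OF that] less.prems(3) by (meson order_trans)
    qed
    ultimately show ?thesis using less.hyps[of H] H by blast
  qed
qed

text \<open>The bound \<open>2 ^ M\<close> is lowered one exponent at a time. At
  \<open>M = 0\<close> the multiplicity is a nonzero integer of size at most 1.\<close>

lemma exists_short_unimodular_triangulation:
  fixes G :: "('n::finite \<Rightarrow> real^'n) set"
  assumes L: "linear L" and "triangulates G C" "\<And>w. w \<in> G \<Longrightarrow> short L l w"
    and "\<And>w. w \<in> G \<Longrightarrow> cone_multiplicity w \<le> 2 ^ M"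
  shows "\<exists>G'. triangulates G' C \<and> (\<forall>w\<in>G'. short L l w \<and> cone_multiplicity w = 1)"
  using assms(2-)
proof (induction M arbitrary: G)
  case 0
  have "cone_multiplicity w = 1" if w: "w \<in> G" for w
  proof -
    obtain k where "cone_multiplicity w * 2 ^ k = 2 ^ l"
      using "0.prems"(2)[OF w] by (auto simp: short_def)
    then have "cone_multiplicity w \<noteq> 0" by auto
    moreover have "cone_multiplicity w \<in> \<int>"
      using "0.prems"(1) w by (intro cone_multiplicity_Ints) (auto simp: triangulates_def)
    moreover have "0 \<le> cone_multiplicity w" by (simp add: cone_multiplicity_def)
    ultimately show ?thesis using "0.prems"(3)[OF w] by (auto elim!: Ints_cases)
  qed
  then show ?case using "0.prems"(1,2) by (intro exI[of _ G]) simp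
next
  case (Suc M)
  obtain G' where "triangulates G' C" "\<forall>w\<in>G'. short L l w \<and> cone_multiplicity w \<le> 2 ^ M"
    using reduce_multiplicity[OF L Suc.prems] by blast
  then show ?case using Suc.IH[of G'] by blast
qed

section \<open>The resulting fan and the dilated simplex\<close>

text \<open>Global uniqueness of coefficients restricts to pairs of cells: two cones meet in the
  cone over their common generators, which is a face of each.\<close>

lemma unimodular_triangulation_if_triangulates:
  fixes G :: "('n::finite \<Rightarrow> real^'n) set"
  assumes G: "triangulates G C" and mult: "\<And>w. w \<in> G \<Longrightarrow> cone_multiplicity w = 1"
  shows "unimodular_triangulation ((\<lambda>w. convex_cone hull (range w)) ` G) C"
proof -
  have T: "finite G" "\<And>w i. w \<in> G \<Longrightarrow> lattice_point (w i)"
    "inj_on lincomb (realization (range ` G))" "lincomb ` realization (range ` G) = C"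
    using G by (auto simp: triangulates_def)
  have "unimodular_cone (convex_cone hull (range w))" if "w \<in> G" for w
    unfolding unimodular_cone_def using that simplicial_cone_unimodular T mult by blast
  moreover have "(\<Union>w\<in>G. convex_cone hull (range w)) = C"
    unfolding T(4)[symmetric] by (subst lincomb_realization_UN) auto
  moreover have "(convex_cone hull (range w) \<inter> convex_cone hull (range u)) face_of (convex_cone hull (range w))"
    if "w \<in> G" "u \<in> G" for w u
  proof -
    have sub: "realization \<A> \<subseteq> realization (range ` G)" if "\<A> \<subseteq> {range w, range u}" for \<A>
      using that \<open>w \<in> G\<close> \<open>u \<in> G\<close> by (intro realization_mono) auto
    then have "inj_on lincomb (realization {range w, range u})" "inj_on lincomb (realization {range w})"
      by (auto intro!: inj_on_subset[OF T(3)] sub simp del: insert_iff)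
    then show ?thesis
      by (simp add: convex_cone_hull_Int face_of_convex_cone_hull_subset)
  qed
  ultimately show ?thesis
    unfolding unimodular_triangulation_def using T(1) by (auto simp: Int_commute) (metis Int_commute)
qed

text \<open>The missing weight \<open>1 - sum b UNIV\<close> goes to the origin, represented by the
  extra index \<open>None\<close>.\<close>

lemma convex_hull_insert_0I:
  fixes v :: "'n::finite \<Rightarrow> 'a::real_vector"
  assumes "\<And>i. 0 \<le> b i" "sum b UNIV \<le> 1"
  shows "(\<Sum>i\<in>UNIV. b i *\<^sub>R v i) \<in> convex hull (insert 0 (range v))"
proof -
  let ?K = "convex hull (insert 0 (range v))"
  have "(\<Sum>i\<in>UNIV. b i *\<^sub>R v i) =
    (\<Sum>i\<in>UNIV. (case i of None \<Rightarrow> 1 - sum b UNIV | Some i \<Rightarrow> b i) *\<^sub>R (case i of None \<Rightarrow> 0 | Some i \<Rightarrow> v i))"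
    by (simp add: UNIV_option_conv sum.reindex)
  also have "\<dots> \<in> ?K"
  proof (rule convex_sum)
    show "(\<Sum>i\<in>UNIV. case i of None \<Rightarrow> 1 - sum b UNIV | Some i \<Rightarrow> b i) = 1"
      by (simp add: UNIV_option_conv sum.reindex)
  qed (use assms in \<open>auto split: option.split simp: hull_inc\<close>)
  finally show ?thesis .
qed

theorem theorem2p1:
  fixes v :: "'n::finite \<Rightarrow> real^'n" and C :: "(real^'n) set" and l :: nat
  assumes "CARD('n) \<ge> 3"
    and "simplicial_cone v C"
    and "cone_multiplicity v = 2 ^ l"
  shows "\<exists>\<T>. unimodular_triangulation \<T> C \<and>
    (\<forall>D\<in>\<T>. hilbert_basis D \<subseteq>
       (\<lambda>x. (real CARD('n) / 2 * (3 / 2) ^ l) *\<^sub>R x) ` cone_simplex v)"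
proof -
  have v: "inj v" "independent (range v)" "C = convex_cone hull (range v)"
    using assms(2) unfolding simplicial_cone_def by blast+
  have lat: "lattice_point (v i)" for i
  proof -
    have "v i \<in> extreme_integral_generators C"
      using assms(2) unfolding simplicial_cone_def by blast
    then show ?thesis by (simp add: extreme_integral_generators_def primitive_def)
  qed
  \<comment> \<open>Independence allows prescribing the value 1 on all generators; within
    \<open>C\<close>, the simplex is then the part where \<open>L\<close> is at most 1.\<close>
  obtain L :: "real^'n \<Rightarrow> real" where L: "linear L" "\<And>i. L (v i) = 1"
    using linear_independent_extend[OF v(2), of "\<lambda>_. 1"] by auto
  have "triangulates {v} C"
    using v lat by (simp add: triangulates_def inj_on_lincomb_independent convex_cone_hull_finite)
  moreover have "short L l v"
    \<comment> \<open>With no subdivision made, the sum is exactly the dimension, and the single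
      values 1 are at most half the dimension since that is at least 3.\<close>
    unfolding short_def using assms L by (intro exI[of _ 0]) auto
  ultimately obtain G where G: "triangulates G C"
      "\<And>w. w \<in> G \<Longrightarrow> short L l w" "\<And>w. w \<in> G \<Longrightarrow> cone_multiplicity w = 1"
    using exists_short_unimodular_triangulation[OF L(1), of "{v}" C l l] assms(3) by auto
  define c where "c = real CARD('n) / 2 * (3 / 2) ^ l"
  have c: "c > 0" by (simp add: c_def)
  have "w i \<in> (\<lambda>x. c *\<^sub>R x) ` cone_simplex v" if w: "w \<in> G" for w i
  proof -
    obtain k where k: "cone_multiplicity w * 2 ^ k = 2 ^ l"
      "L (w i) \<le> real CARD('n) / 2 * (3 / 2) ^ k"
      using G(2)[OF w] by (auto simp: short_def)
    \<comment> \<open>Multiplicity 1 forces \<open>2 ^ k = 2 ^ l\<close>, so exactly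
      \<open>l\<close> subdivisions were counted.\<close>
    then have le: "L (w i) \<le> c" using G(3)[OF w] by (simp add: c_def)
    have "w i \<in> C"
      using unimodular_triangulation_if_triangulates[OF G(1,3)] w hull_inc[of "w i" "range w"]
      by (auto simp: unimodular_triangulation_def)
    then obtain a where a: "\<And>j. 0 \<le> a j" "w i = (\<Sum>j\<in>UNIV. a j *\<^sub>R v j)"
      using v convex_cone_hull_range_iff by blast
    \<comment> \<open>On \<open>C\<close> the form \<open>L\<close> is the sum of the coordinates
      with respect to \<open>v\<close>, so \<open>le\<close> says that after division by
      \<open>c\<close> they sum to at most 1.\<close>
    have "sum a UNIV = L (w i)"
      unfolding a(2) using L by (simp add: linear_sum linear_scale)
    then have "(\<Sum>j\<in>UNIV. (a j / c) *\<^sub>R v j) \<in> cone_simplex v"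
      unfolding cone_simplex_def using a c le
      by (intro convex_hull_insert_0I) (auto simp flip: sum_divide_distrib)
    moreover have "w i = c *\<^sub>R (\<Sum>j\<in>UNIV. (a j / c) *\<^sub>R v j)"
      using c by (simp add: a(2) scaleR_sum_right)
    ultimately show ?thesis by blast
  qed
  moreover have "hilbert_basis (convex_cone hull (range w)) \<subseteq> range w" if "w \<in> G" for w
    using that G by (intro hilbert_basis_unimodular) (auto simp: triangulates_def)
  ultimately show ?thesis
    using unimodular_triangulation_if_triangulates[OF G(1,3)] unfolding c_def
    by (intro exI[of _ "(\<lambda>w. convex_cone hull (range w)) ` G"]) blast
qed

end
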